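(* Let $s,t\in[0,T]$ be such that $R_s\boldsymbol e^3\neq\pm R_t\boldsymbol e^3$ and assume that there uniquely exist two pairs $(\boldsymbol\Gamma_\ell)_{\ell=1}^2$ and $(\boldsymbol\Gamma^*_\ell)_{\ell=1}^2$ of straight lines of the form $$\boldsymbol\Gamma_\ell\colon\mathbb{R}\to\mathbb{R}^2,\quad\boldsymbol\Gamma_\ell(\xi)=-b\,\boldsymbol w_\ell^1+\xi\,\boldsymbol w_\ell^2,\qquad \boldsymbol\Gamma^*_\ell\colon\mathbb{R}\to\mathbb{R}^2,\quad\boldsymbol\Gamma^*_\ell(\xi)=\frac{k_0^2}{b}\boldsymbol w_\ell^1-\xi\,\boldsymbol w_\ell^2,\qquad\ell\in\{1,2\},$$ for some parameter $b\in(0,\infty)$ and two positively oriented orthonormal bases $(\boldsymbol w_1^j)_{j=1}^2$ and $(\boldsymbol w_2^j)_{j=1}^2$ of $\mathbb{R}^2$ such that $$\tilde\nu_s(\boldsymbol\Gamma_1(\xi))=\tilde\nu_t(\boldsymbol\Gamma_2(-\xi))\quad\text{for all }\xi\in\mathbb{R}\text{ with }\xi^2>k_0^2-b^2,$$ $$\tilde\nu_s(\boldsymbol\Gamma^*_1(\xi))=\tilde\nu_t(\boldsymbol\Gamma^*_2(\xi))\quad\text{for all }\xi\in\mathbb{R}\text{ with }\xi^2>k_0^2-k_0^4b^{-2}.$$ Then the relative rotation is given by $$R_s^\top R_t=Q^{(3)}(\arg(\boldsymbol w_1^1))\,Q^{(2)}(2\arctan(\tfrac{b}{k_0}))\,Q^{(3)}(\pi-\arg(\boldsymbol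 w_2^1)).$$
   Context: Fix $k_0>0$, $T>0$. $f\colon\mathbb{R}^3\to[0,\infty)$ is a piecewise continuous function supported in an open ball around $\boldsymbol 0$; $\mathcal{F}[f](\boldsymbol y)=(2\pi)^{-3/2}\int_{\mathbb{R}^3}f(\boldsymbol x)\,e^{-i\langle\boldsymbol x,\boldsymbol y\rangle}\,d\boldsymbol x$. For each $t\in[0,T]$ let $R_t\in\mathrm{SO}(3)$, with $R_0=I$; $\boldsymbol e^3=(0,0,1)^\top$. For $\boldsymbol k\in\mathcal{B}^2_{k_0}=\{\boldsymbol k\in\mathbb{R}^2:\|\boldsymbol k\|<k_0\}$ let $\kappa(\boldsymbol k)=\sqrt{k_0^2-\|\boldsymbol k\|^2}$, $\boldsymbol h(\boldsymbol k)=(k_1,k_2,\kappa(\boldsymbol k)-k_0)^\top$ and $\nu_t(\boldsymbol k)=|\mathcal{F}[f](R_t\boldsymbol h(\boldsymbol k))|^2$. The map $\tau\colon\mathcal{B}^2_{k_0}\setminus\{\boldsymbol 0\}\to\mathbb{R}^2\setminus\overline{\mathcal{B}^2_{k_0}}$, $\tau(\boldsymbol k)=\frac{k_0}{k_0-\kappa(\boldsymbol k)}\boldsymbol k$, is a bijection with inverse $\tau^{-1}(\boldsymbol y)=\frac{2k_0^2}{k_0^2+\|\boldsymbol y\|^2}\boldsymbol y$, and the transformed scaled squared energy is $\tilde\nu_t=\nu_t\circ\tau^{-1}\colon\mathbb{R}^2\setminus\overline{\mathcal{B}^2_{k_0}}\to[0,\infty)$. For a unit vector $\boldsymbol w\in\mathbb{R}^2$,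 $\arg(\boldsymbol w)\in\mathbb{R}/(2\pi\mathbb{Z})$ denotes the angle with $\boldsymbol w=(\cos\arg(\boldsymbol w),\sin\arg(\boldsymbol w))^\top$. $Q^{(2)}(\alpha)=\begin{pmatrix}\cos\alpha&0&\sin\alpha\\0&1&0\\-\sin\alpha&0&\cos\alpha\end{pmatrix}$, $Q^{(3)}(\alpha)=\begin{pmatrix}\cos\alpha&-\sin\alpha&0\\\sin\alpha&\cos\alpha&0\\0&0&1\end{pmatrix}$. *)

theory Defs
  imports "HOL-Analysis.Analysis"
begin

(* Finitely many disjoint open pieces fill the space up to a null set, and f extends
   continuously from each piece to its closure. The values of f on the null set are
   unrestricted, hence the Fourier integral below uses the (complete) Lebesgue measure. *)
definition piecewise_continuous :: "('a::euclidean_space \<Rightarrow> 'b::topological_space) \<Rightarrow> bool" where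
  "piecewise_continuous f \<longleftrightarrow>
     (\<exists>\<U>. finite \<U> \<and> (\<forall>U\<in>\<U>. open U) \<and> disjoint \<U> \<and> negligible (- \<Union>\<U>) \<and>
          (\<forall>U\<in>\<U>. \<exists>g. continuous_on (closure U) g \<and> (\<forall>x\<in>U. g x = f x)))"

definition supported_in_centered_ball :: "('a::real_normed_vector \<Rightarrow> 'b::zero) \<Rightarrow> bool" where
  "supported_in_centered_ball f \<longleftrightarrow> (\<exists>r>0. closure {x. f x \<noteq> 0} \<subseteq> ball 0 r)"

definition fourier :: "(real^3 \<Rightarrow> real) \<Rightarrow> real^3 \<Rightarrow> complex" where
  "fourier f y = of_real ((2 * pi) powr (- 3 / 2)) *
     (LINT x|lebesgue. of_real (f x) * exp (- \<i> * of_real (x \<bullet> y)))"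

definition e3 :: "real^3" where
  "e3 = vector [0, 0, 1]"

definition kappa :: "real \<Rightarrow> real^2 \<Rightarrow> real" where
  "kappa k0 k = sqrt (k0\<^sup>2 - (norm k)\<^sup>2)"

definition hvec :: "real \<Rightarrow> real^2 \<Rightarrow> real^3" where
  "hvec k0 k = vector [k $ 1, k $ 2, kappa k0 k - k0]"

(* Only meaningful for k in the open disk of radius k0. *)
definition scaled_energy ::
    "real \<Rightarrow> (real^3 \<Rightarrow> real) \<Rightarrow> (real \<Rightarrow> real^3^3) \<Rightarrow> real \<Rightarrow> real^2 \<Rightarrow> real" where
  "scaled_energy k0 f R t k = (cmod (fourier f (R t *v hvec k0 k)))\<^sup>2"

definition tau :: "real \<Rightarrow> real^2 \<Rightarrow> real^2" where
  "tau k0 k = (k0 / (k0 - kappa k0 k)) *\<^sub>R k"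

definition tau_inv :: "real \<Rightarrow> real^2 \<Rightarrow> real^2" where
  "tau_inv k0 = inv_into (ball 0 k0 - {0}) (tau k0)"

(* Only meaningful outside the closed disk of radius k0. *)
definition transformed_energy ::
    "real \<Rightarrow> (real^3 \<Rightarrow> real) \<Rightarrow> (real \<Rightarrow> real^3^3) \<Rightarrow> real \<Rightarrow> real^2 \<Rightarrow> real" where
  "transformed_energy k0 f R t = scaled_energy k0 f R t \<circ> tau_inv k0"

lemma kappa_tau_inv_formula:
  assumes "k0 > 0" "norm y > k0"
  shows "kappa k0 ((2 * k0\<^sup>2 / (k0\<^sup>2 + (norm y)\<^sup>2)) *\<^sub>R y) =
         k0 * ((norm y)\<^sup>2 - k0\<^sup>2) / (k0\<^sup>2 + (norm y)\<^sup>2)"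
proof -
  define r where "r = norm y"
  have r: "r > k0" using assms by (simp add: r_def)
  have pos: "k0\<^sup>2 + r\<^sup>2 > 0" using assms by (simp add: add_pos_nonneg)
  have "k0\<^sup>2 - (2 * k0\<^sup>2 / (k0\<^sup>2 + r\<^sup>2) * r)\<^sup>2 = (k0 * (r\<^sup>2 - k0\<^sup>2) / (k0\<^sup>2 + r\<^sup>2))\<^sup>2"
  proof -
    define D where "D = k0\<^sup>2 + r\<^sup>2"
    have D: "D \<noteq> 0" using pos unfolding D_def by linarith
    have "k0\<^sup>2 - (2 * k0\<^sup>2 / D * r)\<^sup>2 = (k0\<^sup>2 * D\<^sup>2 - (2 * k0\<^sup>2 * r)\<^sup>2) / D\<^sup>2"
      using D by (simp add: power_divide power_mult_distrib diff_divide_distrib)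
    also have "k0\<^sup>2 * D\<^sup>2 - (2 * k0\<^sup>2 * r)\<^sup>2 = (k0 * (r\<^sup>2 - k0\<^sup>2))\<^sup>2"
      unfolding D_def by algebra
    finally show ?thesis by (simp add: D_def power_divide)
  qed
  moreover have "k0 * (r\<^sup>2 - k0\<^sup>2) / (k0\<^sup>2 + r\<^sup>2) \<ge> 0"
    using assms(1) r pos by (simp add: power_mono)
  moreover have "(norm ((2 * k0\<^sup>2 / (k0\<^sup>2 + (norm y)\<^sup>2)) *\<^sub>R y))\<^sup>2 = (2 * k0\<^sup>2 / (k0\<^sup>2 + r\<^sup>2) * r)\<^sup>2"
    using pos by (simp add: r_def power_mult_distrib power_divide)
  ultimately show ?thesis
    unfolding kappa_def by (metis r_def real_sqrt_unique)
qed

lemma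
  assumes k0: "k0 > 0"
  shows bij_betw_tau: "bij_betw (tau k0) (ball 0 k0 - {0}) (- cball 0 k0)"
    and tau_inv_eq: "norm y > k0 \<Longrightarrow> tau_inv k0 y = (2 * k0\<^sup>2 / (k0\<^sup>2 + (norm y)\<^sup>2)) *\<^sub>R y"
proof -
  define g :: "real^2 \<Rightarrow> real^2" where "g = (\<lambda>y. (2 * k0\<^sup>2 / (k0\<^sup>2 + (norm y)\<^sup>2)) *\<^sub>R y)"
  have fwd: "g (tau k0 k) = k \<and> norm (tau k0 k) > k0" if "norm k < k0" "k \<noteq> 0" for k :: "real^2"
  proof -
    define c where "c = kappa k0 k"
    have sq: "(norm k)\<^sup>2 < k0\<^sup>2" using that k0 by (simp add: power_strict_mono)
    have c2: "c\<^sup>2 = k0\<^sup>2 - (norm k)\<^sup>2" and c0: "c > 0"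
      using sq by (simp_all add: c_def kappa_def)
    have nk: "(norm k)\<^sup>2 > 0" using that by simp
    have "c\<^sup>2 < k0\<^sup>2" using c2 nk by linarith
    then have cl: "c < k0" using k0 power2_less_imp_less[of c k0] by linarith
    have n: "(norm (tau k0 k))\<^sup>2 = k0\<^sup>2 * (k0 + c) / (k0 - c)"
    proof -
      have "(norm (tau k0 k))\<^sup>2 = (k0 / (k0 - c))\<^sup>2 * (norm k)\<^sup>2"
        by (simp add: tau_def c_def power_mult_distrib power_divide)
      also have "(norm k)\<^sup>2 = (k0 - c) * (k0 + c)"
        using c2 by (simp add: algebra_simps power2_eq_square)
      also have "(k0 / (k0 - c))\<^sup>2 * ((k0 - c) * (k0 + c)) = k0\<^sup>2 * (k0 + c) / (k0 - c)"
        using cl by (simp add: power2_eq_square)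
      finally show ?thesis .
    qed
    have "k0\<^sup>2 * (k0 + c) / (k0 - c) > k0\<^sup>2"
      using cl c0 k0 by (simp add: field_simps)
    then have gt: "norm (tau k0 k) > k0"
      using n k0 by (metis norm_ge_zero power2_less_imp_less)
    have "k0\<^sup>2 + (norm (tau k0 k))\<^sup>2 = 2 * k0 ^ 3 / (k0 - c)"
      unfolding n using cl by (simp add: field_simps power2_eq_square power3_eq_cube)
    then have "2 * k0\<^sup>2 / (k0\<^sup>2 + (norm (tau k0 k))\<^sup>2) * (k0 / (k0 - c)) = 1"
      using cl k0 by (simp add: field_simps power2_eq_square power3_eq_cube)
    then have "g (tau k0 k) = k"
      by (simp add: g_def tau_def c_def)
    with gt show ?thesis by simp
  qed
  have bwd: "tau k0 (g y) = y \<and> norm (g y) < k0 \<and> g y \<noteq> 0" if "norm y > k0" for y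
  proof -
    define r where "r = norm y"
    have r: "r > k0" using that by (simp add: r_def)
    have pos: "k0\<^sup>2 + r\<^sup>2 > 0" using k0 by (simp add: add_pos_nonneg)
    have kap: "kappa k0 (g y) = k0 * (r\<^sup>2 - k0\<^sup>2) / (k0\<^sup>2 + r\<^sup>2)"
      using kappa_tau_inv_formula[OF k0 that] by (simp add: g_def r_def)
    have "k0 - kappa k0 (g y) = 2 * k0 ^ 3 / (k0\<^sup>2 + r\<^sup>2)"
    proof -
      have "k0 = k0 * (k0\<^sup>2 + r\<^sup>2) / (k0\<^sup>2 + r\<^sup>2)" using pos by simp
      then have "k0 - kappa k0 (g y) =
          (k0 * (k0\<^sup>2 + r\<^sup>2) - k0 * (r\<^sup>2 - k0\<^sup>2)) / (k0\<^sup>2 + r\<^sup>2)"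
        unfolding kap by (metis diff_divide_distrib)
      also have "k0 * (k0\<^sup>2 + r\<^sup>2) - k0 * (r\<^sup>2 - k0\<^sup>2) = 2 * k0 ^ 3"
        by algebra
      finally show ?thesis .
    qed
    then have "k0 / (k0 - kappa k0 (g y)) * (2 * k0\<^sup>2 / (k0\<^sup>2 + r\<^sup>2)) = 1"
      using pos k0 by (simp add: power2_eq_square power3_eq_cube)
    then have 1: "tau k0 (g y) = y"
      unfolding tau_def using k0 by (simp add: g_def r_def)
    have "norm (g y) = 2 * k0\<^sup>2 / (k0\<^sup>2 + r\<^sup>2) * r"
      using pos by (simp add: g_def r_def)
    moreover have "2 * k0\<^sup>2 * r < k0 * (k0\<^sup>2 + r\<^sup>2)"
    proof -
      have "0 < k0 * (r - k0)\<^sup>2" using r k0 by simp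
      then show ?thesis by (simp add: power2_eq_square algebra_simps)
    qed
    ultimately have 2: "norm (g y) < k0" using pos by (simp add: field_simps)
    have "y \<noteq> 0" using that k0 by auto
    then have 3: "g y \<noteq> 0" using pos k0 by (simp add: g_def r_def)
    from 1 2 3 show ?thesis by simp
  qed
  show bij: "bij_betw (tau k0) (ball 0 k0 - {0}) (- cball 0 k0)"
    by (rule bij_betw_byWitness[where f' = g]) (use fwd bwd in \<open>auto simp: not_le image_subset_iff\<close>)
  show "tau_inv k0 y = (2 * k0\<^sup>2 / (k0\<^sup>2 + (norm y)\<^sup>2)) *\<^sub>R y" if "norm y > k0"
  proof -
    have "tau_inv k0 (tau k0 (g y)) = g y"
      unfolding tau_inv_def
      by (rule inv_into_f_f) (use bij bwd[OF that] in \<open>auto simp: bij_betw_def\<close>)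
    then show ?thesis using bwd[OF that] by (simp add: g_def)
  qed
qed

(* The representative in (-pi, pi] of the angle modulo 2 pi; it is only used as an argument
   of the 2 pi-periodic function rot3. *)
definition plane_arg :: "real^2 \<Rightarrow> real" where
  "plane_arg w = Arg (Complex (w $ 1) (w $ 2))"

lemma plane_arg:
  assumes "norm w = 1"
  shows "w = vector [cos (plane_arg w), sin (plane_arg w)]"
proof -
  have "cmod (Complex (w $ 1) (w $ 2)) = 1"
    using assms by (simp add: cmod_def norm_vec_def L2_set_def sum_2)
  then show ?thesis
    using rcis_cmod_Arg[of "Complex (w $ 1) (w $ 2)"]
    by (auto simp: plane_arg_def vec_eq_iff forall_2 complex_eq_iff)
qed

definition rot2 :: "real \<Rightarrow> real^3^3" where
  "rot2 \<alpha> = vector [vector [cos \<alpha>, 0, sin \<alpha>],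
                    vector [0, 1, 0],
                    vector [- sin \<alpha>, 0, cos \<alpha>]]"

definition rot3 :: "real \<Rightarrow> real^3^3" where
  "rot3 \<alpha> = vector [vector [cos \<alpha>, - sin \<alpha>, 0],
                    vector [sin \<alpha>, cos \<alpha>, 0],
                    vector [0, 0, 1]]"

(* The determinant is that of the matrix with rows w 1, w 2. *)
definition pos_orthonormal_basis :: "(2 \<Rightarrow> real^2) \<Rightarrow> bool" where
  "pos_orthonormal_basis w \<longleftrightarrow>
     (\<forall>i j. w i \<bullet> w j = (if i = j then 1 else 0)) \<and> det (\<chi> i. w i) > 0"

definition common_line :: "real \<Rightarrow> (2 \<Rightarrow> real^2) \<Rightarrow> real \<Rightarrow> real^2" where
  "common_line b w \<xi> = (- b) *\<^sub>R w 1 + \<xi> *\<^sub>R w 2"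

definition dual_common_line :: "real \<Rightarrow> real \<Rightarrow> (2 \<Rightarrow> real^2) \<Rightarrow> real \<Rightarrow> real^2" where
  "dual_common_line k0 b w \<xi> = (k0\<^sup>2 / b) *\<^sub>R w 1 - \<xi> *\<^sub>R w 2"

(* w l j is the j-th vector of the l-th basis; \<mu>s and \<mu>t are the energies at the two times. *)
definition matching_lines ::
    "real \<Rightarrow> (real^2 \<Rightarrow> real) \<Rightarrow> (real^2 \<Rightarrow> real) \<Rightarrow> real \<Rightarrow> (2 \<Rightarrow> 2 \<Rightarrow> real^2) \<Rightarrow> bool" where
  "matching_lines k0 \<mu>s \<mu>t b w \<longleftrightarrow>
     b > 0 \<and> (\<forall>l. pos_orthonormal_basis (w l)) \<and>
     (\<forall>\<xi>. \<xi>\<^sup>2 > k0\<^sup>2 - b\<^sup>2 \<longrightarrow>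
        \<mu>s (common_line b (w 1) \<xi>) = \<mu>t (common_line b (w 2) (- \<xi>))) \<and>
     (\<forall>\<xi>. \<xi>\<^sup>2 > k0\<^sup>2 - k0 ^ 4 / b\<^sup>2 \<longrightarrow>
        \<mu>s (dual_common_line k0 b (w 1) \<xi>) = \<mu>t (dual_common_line k0 b (w 2) \<xi>))"

end

theory Submission
  imports Defs
begin

text \<open>
  The relative rotation \<open>Q = transpose (R s) ** R t\<close> itself supplies a matching pair of lines,
  so under the uniqueness hypothesis the given pair must be that one, and \<open>Q\<close> can be
  read off from it.

  By \<open>hvec_tau_inv\<close>, the transformed energy at \<open>y\<close> samples the Fourier transform at a
  multiple, depending only on \<open>norm y\<close>, of the rotated point \<open>(y, -k0)\<close>. Hence the energies at
  \<open>y\<close> and \<open>z\<close> of equal norm agree whenever \<open>(y, -k0) = \<plusminus> Q (z, -k0)\<close>; the sign is free because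
  \<open>f\<close> is real (\<open>transformed_energy_eqI\<close>). If \<open>Q\<close> moves \<open>e3\<close> off its axis, it has Euler angles
  \<open>\<phi>, \<theta>, \<psi>\<close> with \<open>0 < \<theta> < pi\<close>. The parameters with \<open>arg (w 1 1) = \<phi>\<close> and \<open>arg (w 2 1) = pi - \<psi>\<close>
  modulo \<open>2 pi\<close> and \<open>b = k0 tan (\<theta> / 2)\<close> then express \<open>Q\<close> in the claimed form (\<open>ex_line_rotation\<close>), and
  a computation with half angles shows that \<open>Q\<close> carries one common line to the
  other with sign \<open>+\<close> and one dual line to the other with sign \<open>-\<close>
  (\<open>matching_lines_line_rotation\<close>). Finally, the curves determine \<open>b\<close> and the first basis vectors
  (\<open>common_line_inject\<close>), hence the rotation.
\<close>

section \<open>The Fourier transform and the measured hemispheres\<close>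

text \<open>A real function has a Hermitian Fourier transform, so antipodal points carry the same
  energy. This is what produces the second, dual pair of lines.\<close>

lemma fourier_uminus: "fourier f (- y) = cnj (fourier f y)"
proof -
  have "(LINT x|lebesgue. of_real (f x) * exp (- \<i> * of_real (x \<bullet> (- y)))) =
        (LINT x|lebesgue. cnj (of_real (f x) * exp (- \<i> * of_real (x \<bullet> y))))"
    by (simp add: exp_cnj)
  also have "\<dots> = cnj (LINT x|lebesgue. of_real (f x) * exp (- \<i> * of_real (x \<bullet> y)))"
    by (rule Bochner_Integration.integral_cnj)
  finally show ?thesis
    unfolding fourier_def by simp
qed

lemma matrix_vector_mult_uminus_right: "A *v (- x) = - (A *v x)"
  for A :: "real^'n^'m"
  using matrix_vector_mult_scaleR[of A "-1" x] by simp

definition proj_plane_point :: "real \<Rightarrow> real^2 \<Rightarrow> real^3" where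
  "proj_plane_point k0 y = vector [y $ 1, y $ 2, - k0]"

text \<open>The map \<open>tau\<close> is the central projection from the origin of the hemisphere parametrized
  by \<open>hvec\<close> onto the plane at height \<open>-k0\<close>. Since rotations fix the origin, planes through
  the origin meet this plane in straight lines.\<close>

lemma hvec_tau_inv:
  assumes "k0 > 0" "norm y > k0"
  shows "hvec k0 (tau_inv k0 y) = (2 * k0\<^sup>2 / (k0\<^sup>2 + (norm y)\<^sup>2)) *\<^sub>R proj_plane_point k0 y"
proof -
  have pos: "k0\<^sup>2 + (norm y)\<^sup>2 > 0"
    using assms by (simp add: add_pos_nonneg)
  have "k0 * ((norm y)\<^sup>2 - k0\<^sup>2) / (k0\<^sup>2 + (norm y)\<^sup>2) - k0
      = (k0 * ((norm y)\<^sup>2 - k0\<^sup>2) - k0 * (k0\<^sup>2 + (norm y)\<^sup>2)) / (k0\<^sup>2 + (norm y)\<^sup>2)"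
    using pos by (simp add: diff_divide_distrib)
  also have "k0 * ((norm y)\<^sup>2 - k0\<^sup>2) - k0 * (k0\<^sup>2 + (norm y)\<^sup>2) = - (2 * k0\<^sup>2 * k0)"
    by (simp add: algebra_simps power2_eq_square)
  finally have "k0 * ((norm y)\<^sup>2 - k0\<^sup>2) / (k0\<^sup>2 + (norm y)\<^sup>2) - k0
      = - (2 * k0\<^sup>2 / (k0\<^sup>2 + (norm y)\<^sup>2) * k0)"
    by simp
  then show ?thesis
    using kappa_tau_inv_formula[OF assms]
    by (simp add: tau_inv_eq[OF assms] hvec_def proj_plane_point_def vec_eq_iff forall_3)
qed

text \<open>Two outer points of equal norm lie over points of the hemispheres that are scaled by the
  same factor, so the rotated sample points coincide up to sign as soon as the projected
  ones do.\<close>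

lemma transformed_energy_eqI:
  assumes "k0 > 0" "norm y > k0" "norm z = norm y"
    and "R s *v proj_plane_point k0 y = R t *v proj_plane_point k0 z \<or>
         R s *v proj_plane_point k0 y = - (R t *v proj_plane_point k0 z)"
  shows "transformed_energy k0 f R s y = transformed_energy k0 f R t z"
proof -
  define c where "c = 2 * k0\<^sup>2 / (k0\<^sup>2 + (norm y)\<^sup>2)"
  have "R s *v hvec k0 (tau_inv k0 y) = c *\<^sub>R (R s *v proj_plane_point k0 y)"
    using assms by (simp add: hvec_tau_inv c_def matrix_vector_mult_scaleR)
  moreover have "R t *v hvec k0 (tau_inv k0 z) = c *\<^sub>R (R t *v proj_plane_point k0 z)"
    using assms by (simp add: hvec_tau_inv c_def matrix_vector_mult_scaleR)
  ultimately have "R s *v hvec k0 (tau_inv k0 y) = R t *v hvec k0 (tau_inv k0 z) \<or>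
      R s *v hvec k0 (tau_inv k0 y) = - (R t *v hvec k0 (tau_inv k0 z))"
    using assms(4) by auto
  then show ?thesis
    by (auto simp: transformed_energy_def scaled_energy_def fourier_uminus)
qed

section \<open>Positively oriented bases and the lines that they define\<close>

lemma pos_orthonormal_basis_norm:
  assumes "pos_orthonormal_basis w"
  shows "norm (w i) = 1"
  using assms by (simp add: pos_orthonormal_basis_def norm_eq_sqrt_inner)

lemma pos_orthonormal_basis_polar:
  assumes "pos_orthonormal_basis w"
  shows "w 1 = vector [cos (plane_arg (w 1)), sin (plane_arg (w 1))]"
    and "w 2 = vector [- sin (plane_arg (w 1)), cos (plane_arg (w 1))]"
proof -
  define c s where "c = cos (plane_arg (w 1))" and "s = sin (plane_arg (w 1))"
  have w1: "w 1 = vector [c, s]"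
    using plane_arg[OF pos_orthonormal_basis_norm[OF assms, of 1]] by (simp add: c_def s_def)
  then show "w 1 = vector [cos (plane_arg (w 1)), sin (plane_arg (w 1))]"
    by (simp add: c_def s_def)
  define x y where "x = w 2 $ 1" and "y = w 2 $ 2"
  have cs: "c\<^sup>2 + s\<^sup>2 = 1" by (simp add: c_def s_def)
  have "w 1 \<bullet> w 2 = 0" "w 2 \<bullet> w 2 = 1"
    using assms by (auto simp: pos_orthonormal_basis_def)
  then have orth: "c * x + s * y = 0" and unit: "x\<^sup>2 + y\<^sup>2 = 1"
    by (simp_all add: w1 inner_vec_def sum_2 x_def y_def power2_eq_square)
  have pos: "c * y - s * x > 0"
    using assms by (simp add: pos_orthonormal_basis_def det_2 w1 x_def y_def)
  have "(c * y - s * x)\<^sup>2 = 1"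
    using cs orth unit by algebra
  then have "c * y - s * x = 1"
    using pos by (simp add: power2_eq_1_iff)
  then have "y = c" "x = - s"
    using cs orth by algebra+
  then show "w 2 = vector [- sin (plane_arg (w 1)), cos (plane_arg (w 1))]"
    by (simp add: vec_eq_iff forall_2 x_def y_def c_def s_def)
qed

lemma ex_pos_orthonormal_basis:
  obtains w where "pos_orthonormal_basis w"
    and "cos (plane_arg (w 1)) = cos \<phi>" and "sin (plane_arg (w 1)) = sin \<phi>"
proof -
  define w :: "2 \<Rightarrow> real^2"
    where "w = (\<lambda>i. if i = 1 then vector [cos \<phi>, sin \<phi>] else vector [- sin \<phi>, cos \<phi>])"
  have "pos_orthonormal_basis w"
    by (auto simp: pos_orthonormal_basis_def w_def forall_2 det_2 inner_vec_def sum_2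
        simp flip: power2_eq_square)
  moreover have "cos (plane_arg (w 1)) = cos \<phi>" "sin (plane_arg (w 1)) = sin \<phi>"
    using pos_orthonormal_basis_polar(1)[OF \<open>pos_orthonormal_basis w\<close>]
    by (auto simp: w_def vec_eq_iff forall_2)
  ultimately show thesis by (rule that)
qed

lemma common_line_inject:
  assumes "pos_orthonormal_basis w" "pos_orthonormal_basis w'" "b > 0" "b' > 0"
    and eq: "common_line b w = common_line b' w'"
  shows "b = b'" and "w 1 = w' 1"
proof -
  have *: "b *\<^sub>R w 1 = b' *\<^sub>R w' 1"
    using fun_cong[OF eq, of 0] by (simp add: common_line_def)
  then have "norm (b *\<^sub>R w 1) = norm (b' *\<^sub>R w' 1)" by simp
  then show "b = b'"
    using assms by (simp add: pos_orthonormal_basis_norm)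
  with * assms show "w 1 = w' 1" by simp
qed

lemma norm_comb_sq:
  assumes "pos_orthonormal_basis w"
  shows "(norm (a *\<^sub>R w 1 + c *\<^sub>R w 2))\<^sup>2 = a\<^sup>2 + c\<^sup>2"
proof -
  have "w 1 \<bullet> w 1 = 1" "w 2 \<bullet> w 2 = 1" "w 1 \<bullet> w 2 = 0" "w 2 \<bullet> w 1 = 0"
    using assms by (auto simp: pos_orthonormal_basis_def)
  then show ?thesis
    unfolding power2_norm_eq_inner
    by (simp add: inner_add_left inner_add_right power2_eq_square)
qed

section \<open>Euler angles\<close>

lemma rot3_add: "rot3 (\<alpha> + \<beta>) = rot3 \<alpha> ** rot3 \<beta>"
  by (simp add: rot3_def vec_eq_iff forall_3 matrix_matrix_mult_def sum_3 cos_add sin_add)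

lemma rot2_add: "rot2 (\<alpha> + \<beta>) = rot2 \<alpha> ** rot2 \<beta>"
  by (simp add: rot2_def vec_eq_iff forall_3 matrix_matrix_mult_def sum_3 cos_add sin_add)

lemma rot_zero [simp]: "rot3 0 = mat 1" "rot2 0 = mat 1"
  by (simp_all add: rot3_def rot2_def vec_eq_iff forall_3 mat_def)

lemma rotation_matrix_rot3: "rotation_matrix (rot3 \<alpha>)"
  by (simp add: rotation_matrix_def orthogonal_matrix rot3_def det_3 vec_eq_iff forall_3
      matrix_matrix_mult_def transpose_def mat_def sum_3 flip: power2_eq_square)

lemma rotation_matrix_rot2: "rotation_matrix (rot2 \<alpha>)"
  by (simp add: rotation_matrix_def orthogonal_matrix rot2_def det_3 vec_eq_iff forall_3
      matrix_matrix_mult_def transpose_def mat_def sum_3 flip: power2_eq_square)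

lemma rotation_matrix_mul:
  "rotation_matrix A \<Longrightarrow> rotation_matrix B \<Longrightarrow> rotation_matrix (A ** B)"
  for A B :: "real^'n^'n"
  by (simp add: rotation_matrix_def orthogonal_matrix_mul det_mul)

lemma rot3_cong: "cos \<alpha> = cos \<beta> \<Longrightarrow> sin \<alpha> = sin \<beta> \<Longrightarrow> rot3 \<alpha> = rot3 \<beta>"
  by (simp add: rot3_def)

lemma rotation_matrix_fixing_e3:
  assumes P: "rotation_matrix P" and fixed: "P *v e3 = e3"
  obtains \<psi> where "P = rot3 \<psi>"
proof -
  have PT: "transpose P ** P = mat 1" "det P = 1"
    using P by (auto simp: rotation_matrix_def orthogonal_matrix)
  have "transpose P *v e3 = transpose P *v (P *v e3)" by (simp add: fixed)
  also have "\<dots> = e3" by (simp add: matrix_vector_mul_assoc PT)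
  finally have row: "P $ 3 $ 1 = 0" "P $ 3 $ 2 = 0"
    by (simp_all add: e3_def vec_eq_iff forall_3 matrix_vector_mult_def transpose_def sum_3)
  have col: "P $ 1 $ 3 = 0" "P $ 2 $ 3 = 0" "P $ 3 $ 3 = 1"
    using fixed by (simp_all add: e3_def vec_eq_iff forall_3 matrix_vector_mult_def sum_3)
  define a b c d where "a = P $ 1 $ 1" and "b = P $ 1 $ 2" and "c = P $ 2 $ 1" and "d = P $ 2 $ 2"
  note defs = a_def b_def c_def d_def
  have "a\<^sup>2 + c\<^sup>2 = 1" "a * b + c * d = 0"
    using PT(1) row by (simp_all add: vec_eq_iff forall_3 matrix_matrix_mult_def transpose_def
        sum_3 mat_def defs power2_eq_square)
  moreover have "a * d - b * c = 1"
    using PT(2) row col by (simp add: det_3 defs)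
  ultimately have "d = a" "b = - c" by algebra+
  from \<open>a\<^sup>2 + c\<^sup>2 = 1\<close> obtain \<psi> where "a = cos \<psi>" "c = sin \<psi>"
    by (metis sincos_total_2pi)
  with \<open>d = a\<close> \<open>b = - c\<close> row col have "P = rot3 \<psi>"
    by (simp add: rot3_def vec_eq_iff forall_3 defs)
  then show thesis by (rule that)
qed

text \<open>The angles \<open>\<phi>\<close> and \<open>\<theta>\<close> are the spherical coordinates of the image of \<open>e3\<close>; undoing
  the two corresponding rotations leaves a rotation about \<open>e3\<close>. The excluded poles are
  exactly the cases in which \<open>\<theta>\<close> would be \<open>0\<close> or \<open>pi\<close>.\<close>

lemma euler_angles:
  assumes Q: "rotation_matrix Q" and "Q *v e3 \<noteq> e3" "Q *v e3 \<noteq> - e3"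
  obtains \<phi> \<theta> \<psi> where "0 < \<theta>" "\<theta> < pi" "Q = rot3 \<phi> ** rot2 \<theta> ** rot3 \<psi>"
proof -
  define q where "q = Q *v e3"
  have "orthogonal_transformation ((*v) Q)"
    using Q by (simp add: rotation_matrix_def orthogonal_transformation_matrix)
  then have "q \<bullet> q = e3 \<bullet> e3" by (simp add: q_def orthogonal_transformation_def)
  then have unit: "(q $ 1)\<^sup>2 + (q $ 2)\<^sup>2 + (q $ 3)\<^sup>2 = 1"
    by (simp add: inner_vec_def sum_3 e3_def power2_eq_square)
  have pole: "(q $ 1)\<^sup>2 + (q $ 2)\<^sup>2 \<noteq> 0"
  proof
    assume "(q $ 1)\<^sup>2 + (q $ 2)\<^sup>2 = 0"
    then have "q $ 1 = 0" "q $ 2 = 0" by (simp_all add: sum_power2_eq_zero_iff)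
    moreover from this have "q $ 3 = 1 \<or> q $ 3 = - 1" using unit by (simp add: power2_eq_1_iff)
    ultimately have "q = e3 \<or> q = - e3"
      by (auto simp: e3_def vec_eq_iff forall_3)
    with assms q_def show False by blast
  qed
  moreover have "(q $ 1)\<^sup>2 + (q $ 2)\<^sup>2 \<ge> 0" by simp
  ultimately have "(q $ 3)\<^sup>2 < 1" using unit by linarith
  then have bds: "- 1 < q $ 3" "q $ 3 < 1"
    using abs_square_less_1[of "q $ 3"] by auto
  define \<theta> where "\<theta> = arccos (q $ 3)"
  have \<theta>: "0 < \<theta>" "\<theta> < pi" "cos \<theta> = q $ 3"
    using bds arccos_lt_bounded[OF bds] by (auto simp: \<theta>_def)
  then have sp: "sin \<theta> > 0" by (simp add: sin_gt_zero)
  have "(sin \<theta>)\<^sup>2 = (q $ 1)\<^sup>2 + (q $ 2)\<^sup>2"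
    using unit \<theta>(3) sin_cos_squared_add[of \<theta>] by simp
  then have "(q $ 1 / sin \<theta>)\<^sup>2 + (q $ 2 / sin \<theta>)\<^sup>2 = 1"
    using sp pole by (simp add: power_divide flip: add_divide_distrib)
  then obtain \<phi> where "q $ 1 / sin \<theta> = cos \<phi>" "q $ 2 / sin \<theta> = sin \<phi>"
    by (metis sincos_total_2pi)
  then have q: "q $ 1 = cos \<phi> * sin \<theta>" "q $ 2 = sin \<phi> * sin \<theta>"
    using sp by (auto simp: field_simps)
  have "(rot3 \<phi> ** rot2 \<theta>) *v e3 = q"
    by (simp add: e3_def vec_eq_iff forall_3 matrix_vector_mult_def matrix_matrix_mult_def sum_3
        rot3_def rot2_def q \<theta>)
  moreover have inv: "(rot2 (- \<theta>) ** rot3 (- \<phi>)) ** (rot3 \<phi> ** rot2 \<theta>) = mat 1"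
  proof -
    have "(rot2 (- \<theta>) ** rot3 (- \<phi>)) ** (rot3 \<phi> ** rot2 \<theta>)
        = rot2 (- \<theta>) ** (rot3 (- \<phi>) ** rot3 \<phi>) ** rot2 \<theta>"
      by (simp only: matrix_mul_assoc)
    then show ?thesis by (simp flip: rot3_add rot2_add)
  qed
  ultimately have "(rot2 (- \<theta>) ** rot3 (- \<phi>)) *v q = e3"
    by (metis matrix_vector_mul_assoc matrix_vector_mul_lid)
  then have "(rot2 (- \<theta>) ** rot3 (- \<phi>) ** Q) *v e3 = e3"
    by (simp add: q_def matrix_vector_mul_assoc)
  then obtain \<psi> where \<psi>: "rot2 (- \<theta>) ** rot3 (- \<phi>) ** Q = rot3 \<psi>"
    by (meson rotation_matrix_fixing_e3 rotation_matrix_mul rotation_matrix_rot2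
        rotation_matrix_rot3 Q)
  have "(rot3 \<phi> ** rot2 \<theta>) ** (rot2 (- \<theta>) ** rot3 (- \<phi>)) = mat 1"
    using inv matrix_left_right_inverse by blast
  then have "Q = (rot3 \<phi> ** rot2 \<theta>) ** (rot2 (- \<theta>) ** rot3 (- \<phi>)) ** Q" by simp
  also have "\<dots> = rot3 \<phi> ** rot2 \<theta> ** rot3 \<psi>" by (simp add: matrix_mul_assoc flip: \<psi>)
  finally show thesis using that \<theta> by blast
qed

section \<open>The lines of a rotation\<close>

abbreviation line_rotation :: "real \<Rightarrow> real \<Rightarrow> (2 \<Rightarrow> 2 \<Rightarrow> real^2) \<Rightarrow> real^3^3" where
  "line_rotation k0 b w \<equiv>
     rot3 (plane_arg (w 1 1)) ** rot2 (2 * arctan (b / k0)) ** rot3 (pi - plane_arg (w 2 1))"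

text \<open>Since \<open>0 < \<theta> / 2 < pi / 2\<close>, the distance \<open>b = k0 tan (\<theta> / 2)\<close> is positive and recovers
  the middle Euler angle. The last angle \<open>\<psi>\<close> enters as \<open>pi - \<psi>\<close> because the normal of the
  second line points, before the middle rotation, opposite to that of the first.\<close>

lemma ex_line_rotation:
  assumes "k0 > 0" and Q: "rotation_matrix Q" "Q *v e3 \<noteq> e3" "Q *v e3 \<noteq> - e3"
  obtains b w where "b > 0" "\<forall>l. pos_orthonormal_basis (w l)" "Q = line_rotation k0 b w"
proof -
  obtain \<phi> \<theta> \<psi> where \<theta>: "0 < \<theta>" "\<theta> < pi" and Q_eq: "Q = rot3 \<phi> ** rot2 \<theta> ** rot3 \<psi>"
    using euler_angles[OF Q] .
  obtain u where u: "pos_orthonormal_basis u"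
      "cos (plane_arg (u 1)) = cos \<phi>" "sin (plane_arg (u 1)) = sin \<phi>"
    by (rule ex_pos_orthonormal_basis)
  obtain v where v: "pos_orthonormal_basis v"
      "cos (plane_arg (v 1)) = cos (pi - \<psi>)" "sin (plane_arg (v 1)) = sin (pi - \<psi>)"
    by (rule ex_pos_orthonormal_basis)
  define b where "b = k0 * tan (\<theta> / 2)"
  define w :: "2 \<Rightarrow> 2 \<Rightarrow> real^2" where "w = (\<lambda>l. if l = 1 then u else v)"
  show thesis
  proof
    show "b > 0"
      using assms(1) \<theta> by (simp add: b_def tan_gt_zero)
    show "\<forall>l. pos_orthonormal_basis (w l)"
      using u(1) v(1) by (simp add: w_def)
    have "2 * arctan (b / k0) = \<theta>"
      using assms(1) \<theta> by (simp add: b_def arctan_tan)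
    moreover have "rot3 (plane_arg (w 1 1)) = rot3 \<phi>"
      using u(2,3) by (intro rot3_cong) (simp_all add: w_def)
    moreover have "rot3 (pi - plane_arg (w 2 1)) = rot3 \<psi>"
      using v(2,3) by (intro rot3_cong) (simp_all add: w_def cos_diff sin_diff)
    ultimately show "Q = line_rotation k0 b w"
      using Q_eq by (simp only:)
  qed
qed

lemma double_arctan_quotient:
  assumes "k0 > 0"
  shows "cos (2 * arctan (b / k0)) = (k0\<^sup>2 - b\<^sup>2) / (k0\<^sup>2 + b\<^sup>2)"
    and "sin (2 * arctan (b / k0)) = 2 * b * k0 / (k0\<^sup>2 + b\<^sup>2)"
proof -
  have *: "1 + (b / k0)\<^sup>2 = (k0\<^sup>2 + b\<^sup>2) / k0\<^sup>2" "1 - (b / k0)\<^sup>2 = (k0\<^sup>2 - b\<^sup>2) / k0\<^sup>2"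
    using assms by (simp_all add: power_divide add_divide_distrib diff_divide_distrib)
  show "cos (2 * arctan (b / k0)) = (k0\<^sup>2 - b\<^sup>2) / (k0\<^sup>2 + b\<^sup>2)"
    using assms by (simp add: cos_tan_half tan_arctan *)
  show "sin (2 * arctan (b / k0)) = 2 * b * k0 / (k0\<^sup>2 + b\<^sup>2)"
    using assms by (simp add: sin_tan_half tan_arctan * ) (simp add: power2_eq_square)
qed

lemma proj_plane_point_basis:
  assumes "pos_orthonormal_basis w"
  shows "proj_plane_point k0 (a *\<^sub>R w 1 + c *\<^sub>R w 2) = rot3 (plane_arg (w 1)) *v vector [a, c, - k0]"
proof -
  have "w 1 $ 1 = cos (plane_arg (w 1))" "w 1 $ 2 = sin (plane_arg (w 1))"
    "w 2 $ 1 = - sin (plane_arg (w 1))" "w 2 $ 2 = cos (plane_arg (w 1))"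
    using arg_cong[OF pos_orthonormal_basis_polar(1)[OF assms], of "\<lambda>v. v $ 1"]
      arg_cong[OF pos_orthonormal_basis_polar(1)[OF assms], of "\<lambda>v. v $ 2"]
      arg_cong[OF pos_orthonormal_basis_polar(2)[OF assms], of "\<lambda>v. v $ 1"]
      arg_cong[OF pos_orthonormal_basis_polar(2)[OF assms], of "\<lambda>v. v $ 2"]
    by simp_all
  then show ?thesis
    by (simp add: proj_plane_point_def vec_eq_iff forall_3 matrix_vector_mult_def sum_3 rot3_def)
qed

lemma line_rotation_proj_plane_point:
  assumes "pos_orthonormal_basis (w 2)"
  shows "line_rotation k0 b w *v proj_plane_point k0 (a *\<^sub>R w 2 1 + c *\<^sub>R w 2 2) =
    rot3 (plane_arg (w 1 1)) *v (rot2 (2 * arctan (b / k0)) *v vector [- a, - c, - k0])"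
proof -
  have "rot3 (pi - plane_arg (w 2 1)) *v proj_plane_point k0 (a *\<^sub>R w 2 1 + c *\<^sub>R w 2 2)
      = rot3 pi *v vector [a, c, - k0]"
    by (simp add: proj_plane_point_basis[OF assms] matrix_vector_mul_assoc flip: rot3_add)
  also have "\<dots> = vector [- a, - c, - k0]"
    by (simp add: vec_eq_iff forall_3 matrix_vector_mult_def sum_3 rot3_def)
  finally show ?thesis
    by (simp flip: matrix_vector_mul_assoc)
qed

text \<open>In the plane spanned by the first and third axes, the directions \<open>(b, -k0)\<close> and
  \<open>(-b, -k0)\<close> enclose the angle \<open>2 arctan (b / k0)\<close> of \<open>rot2\<close>, which therefore carries the first
  to the second. The directions \<open>(-k0\<^sup>2 / b, -k0)\<close> and \<open>(k0\<^sup>2 / b, -k0)\<close> are orthogonal to the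
  first and the second, respectively, but on opposite sides, hence the sign in the dual case.\<close>

lemma
  assumes "k0 > 0" "b > 0" and w: "\<forall>l. pos_orthonormal_basis (w l)"
  shows line_rotation_common_line:
      "line_rotation k0 b w *v proj_plane_point k0 (common_line b (w 2) (- \<xi>)) =
       proj_plane_point k0 (common_line b (w 1) \<xi>)" (is ?primal)
    and line_rotation_dual_common_line:
      "line_rotation k0 b w *v proj_plane_point k0 (dual_common_line k0 b (w 2) \<xi>) =
       - proj_plane_point k0 (dual_common_line k0 b (w 1) \<xi>)" (is ?dual)
proof -
  have pos: "k0\<^sup>2 + b\<^sup>2 > 0"
    using assms by (simp add: add_pos_nonneg)
  define C S where "C = (k0\<^sup>2 - b\<^sup>2) / (k0\<^sup>2 + b\<^sup>2)" and "S = 2 * b * k0 / (k0\<^sup>2 + b\<^sup>2)"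
  \<comment> \<open>\<open>C\<close> and \<open>S\<close> are the cosine and sine of \<open>2 arctan (b / k0)\<close>.\<close>
  have CS: "C * (k0\<^sup>2 + b\<^sup>2) = k0\<^sup>2 - b\<^sup>2" "S * (k0\<^sup>2 + b\<^sup>2) = 2 * b * k0"
    using pos by (simp_all add: C_def S_def)
  have "(C * b - S * k0) * (k0\<^sup>2 + b\<^sup>2) = (- b) * (k0\<^sup>2 + b\<^sup>2)"
    using CS by algebra
  then have C: "C * b - S * k0 = - b"
    using pos by (subst (asm) mult_right_cancel) auto
  have "(S * b + C * k0) * (k0\<^sup>2 + b\<^sup>2) = k0 * (k0\<^sup>2 + b\<^sup>2)"
    using CS by algebra
  then have S: "S * b + C * k0 = k0"
    using pos by (subst (asm) mult_right_cancel) auto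
  have "C * (k0\<^sup>2 / b) + S * k0 = k0 * (S * b + C * k0) / b"
    "S * (k0\<^sup>2 / b) - C * k0 = - k0 * (C * b - S * k0) / b"
    using assms(2) by (simp_all add: field_simps power2_eq_square)
  then have C': "C * (k0\<^sup>2 / b) + S * k0 = k0\<^sup>2 / b" and S': "S * (k0\<^sup>2 / b) - C * k0 = k0"
    unfolding C S using assms(2) by (simp_all add: power2_eq_square)
  have rot2: "rot2 (2 * arctan (b / k0)) = vector [vector [C, 0, S], vector [0, 1, 0], vector [- S, 0, C]]"
    by (simp add: rot2_def double_arctan_quotient[OF assms(1)] C_def S_def)
  have "rot2 (2 * arctan (b / k0)) *v vector [b, \<xi>, - k0] = vector [- b, \<xi>, - k0]"
    using C S by (simp add: rot2 vec_eq_iff forall_3 matrix_vector_mult_def sum_3)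
  then show ?primal
    unfolding common_line_def
      line_rotation_proj_plane_point[where w = w, OF spec[OF w, of 2]] proj_plane_point_basis[OF spec[OF w, of 1]]
    by (simp only: minus_minus)
  have dual: "dual_common_line k0 b v \<xi> = (k0\<^sup>2 / b) *\<^sub>R v 1 + (- \<xi>) *\<^sub>R v 2" for v
    by (simp add: dual_common_line_def)
  have "rot2 (2 * arctan (b / k0)) *v vector [- (k0\<^sup>2 / b), \<xi>, - k0] = - vector [k0\<^sup>2 / b, - \<xi>, - k0]"
    using C' S' by (simp add: rot2 vec_eq_iff forall_3 matrix_vector_mult_def sum_3)
  then show ?dual
    unfolding dual
      line_rotation_proj_plane_point[where w = w, OF spec[OF w, of 2]] proj_plane_point_basis[OF spec[OF w, of 1]]
    by (simp only: minus_minus matrix_vector_mult_uminus_right)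
qed

lemma matching_lines_line_rotation:
  assumes "k0 > 0" "b > 0" and w: "\<forall>l. pos_orthonormal_basis (w l)"
    and R: "R t = R s ** line_rotation k0 b w"
  shows "matching_lines k0 (transformed_energy k0 f R s) (transformed_energy k0 f R t) b w"
  unfolding matching_lines_def
proof (intro conjI allI impI)
  fix \<xi> :: real
  have n: "(norm (common_line b (w l) \<zeta>))\<^sup>2 = b\<^sup>2 + \<zeta>\<^sup>2" for l \<zeta>
    using norm_comb_sq[of "w l" "- b" \<zeta>] w by (simp add: common_line_def)
  assume "\<xi>\<^sup>2 > k0\<^sup>2 - b\<^sup>2"
  then have "k0\<^sup>2 < (norm (common_line b (w 1) \<xi>))\<^sup>2" by (simp add: n)
  then have "k0 < norm (common_line b (w 1) \<xi>)" by (rule power2_less_imp_less) simp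
  moreover have "norm (common_line b (w 2) (- \<xi>)) = norm (common_line b (w 1) \<xi>)"
    by (rule power2_eq_imp_eq) (simp_all add: n)
  ultimately show "transformed_energy k0 f R s (common_line b (w 1) \<xi>) =
      transformed_energy k0 f R t (common_line b (w 2) (- \<xi>))"
    using assms(1) line_rotation_common_line[OF assms(1,2) w, of \<xi>]
    by (intro transformed_energy_eqI) (simp_all add: R flip: matrix_vector_mul_assoc)
next
  fix \<xi> :: real
  have n: "(norm (dual_common_line k0 b (w l) \<xi>))\<^sup>2 = k0 ^ 4 / b\<^sup>2 + \<xi>\<^sup>2" for l
    using norm_comb_sq[of "w l" "k0\<^sup>2 / b" "- \<xi>"] w
    by (simp add: dual_common_line_def power_divide)
  assume "\<xi>\<^sup>2 > k0\<^sup>2 - k0 ^ 4 / b\<^sup>2"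
  then have "k0\<^sup>2 < (norm (dual_common_line k0 b (w 1) \<xi>))\<^sup>2" by (simp add: n)
  then have "k0 < norm (dual_common_line k0 b (w 1) \<xi>)" by (rule power2_less_imp_less) simp
  moreover have "norm (dual_common_line k0 b (w 2) \<xi>) = norm (dual_common_line k0 b (w 1) \<xi>)"
    by (rule power2_eq_imp_eq) (simp_all add: n)
  ultimately show "transformed_energy k0 f R s (dual_common_line k0 b (w 1) \<xi>) =
      transformed_energy k0 f R t (dual_common_line k0 b (w 2) \<xi>)"
    using assms(1) line_rotation_dual_common_line[OF assms(1,2) w, of \<xi>]
    by (intro transformed_energy_eqI)
      (simp_all add: R matrix_vector_mult_uminus_right flip: matrix_vector_mul_assoc)
qed (use assms in auto)

section \<open>Reconstruction of the relative rotation\<close>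

theorem theoremD3:
  fixes k0 T s t b :: real
    and f :: "real^3 \<Rightarrow> real"
    and R :: "real \<Rightarrow> real^3^3"
    and w :: "2 \<Rightarrow> 2 \<Rightarrow> real^2"
  assumes "k0 > 0" and "T > 0"
    and "\<forall>x. f x \<ge> 0" and "piecewise_continuous f" and "supported_in_centered_ball f"
    and "\<forall>u\<in>{0..T}. rotation_matrix (R u)" and "R 0 = mat 1"
    and "s \<in> {0..T}" and "t \<in> {0..T}"
    and "R s *v e3 \<noteq> R t *v e3" and "R s *v e3 \<noteq> - (R t *v e3)"
    and unique: "\<exists>!(\<Gamma> :: (2 \<Rightarrow> real \<Rightarrow> real^2) \<times> (2 \<Rightarrow> real \<Rightarrow> real^2)).
          \<exists>b' w'. matching_lines k0 (transformed_energy k0 f R s) (transformed_energy k0 f R t) b' w' \<and>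
            \<Gamma> = (\<lambda>l. common_line b' (w' l), \<lambda>l. dual_common_line k0 b' (w' l))"
    and "matching_lines k0 (transformed_energy k0 f R s) (transformed_energy k0 f R t) b w"
  shows "transpose (R s) ** R t =
           rot3 (plane_arg (w 1 1)) ** rot2 (2 * arctan (b / k0)) ** rot3 (pi - plane_arg (w 2 1))"
proof -
  define Q where "Q = transpose (R s) ** R t"
  have Rs: "orthogonal_matrix (R s)" and Rt: "rotation_matrix (R t)"
    using assms(6,8,9) by (auto simp: rotation_matrix_def)
  have "R s ** Q = (R s ** transpose (R s)) ** R t"
    by (simp add: Q_def matrix_mul_assoc)
  then have RQ: "R t = R s ** Q"
    using Rs by (simp add: orthogonal_matrix_def)
  have rot: "rotation_matrix Q"
    using assms(6,8) Rt
    by (simp add: Q_def rotation_matrix_def orthogonal_matrix_mul orthogonal_matrix_transpose det_mul)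
  have "R t *v e3 = R s *v (Q *v e3)"
    by (simp add: RQ matrix_vector_mul_assoc)
  with assms(10,11) have "Q *v e3 \<noteq> e3" "Q *v e3 \<noteq> - e3"
    by (auto simp: matrix_vector_mult_uminus_right)
  with \<open>k0 > 0\<close> rot obtain b' w' where b': "b' > 0"
    and w': "\<forall>l. pos_orthonormal_basis (w' l)" and Q: "Q = line_rotation k0 b' w'"
    by (rule ex_line_rotation)
  have match': "matching_lines k0 (transformed_energy k0 f R s) (transformed_energy k0 f R t) b' w'"
    using matching_lines_line_rotation[of k0 b' w' R t s f] \<open>k0 > 0\<close> b' w' RQ Q by blast
  have match: "matching_lines k0 (transformed_energy k0 f R s) (transformed_energy k0 f R t) b w"
    by fact
  then have b: "b > 0" and w: "\<forall>l. pos_orthonormal_basis (w l)"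
    by (auto simp: matching_lines_def)
  have "(\<lambda>l. common_line b (w l), \<lambda>l. dual_common_line k0 b (w l)) =
      (\<lambda>l. common_line b' (w' l), \<lambda>l. dual_common_line k0 b' (w' l))"
    using unique match match' by blast
  then have "(\<lambda>l. common_line b (w l)) = (\<lambda>l. common_line b' (w' l))"
    by (rule Pair_inject)
  then have "common_line b (w l) = common_line b' (w' l)" for l
    by (rule fun_cong)
  then have "b = b'" "w l 1 = w' l 1" for l
    using common_line_inject[of "w l" "w' l" b b'] b b' w w' by blast+
  then show ?thesis
    using Q by (simp add: Q_def)
qed

end
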